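(* Let $k\ge 2$ and $n\ge 1$ be integers, let $G$ be a graph that admits a neighborhood-balanced $k$-coloring, and let $S\subsetneq V(G)$ be a nonempty proper subset that is independent in $G$. Then the union $nG_S$ of $n$ copies of $G$ over $S$ admits a neighborhood-balanced $k$-coloring.
   Context: All graphs are finite, simple and undirected. A neighborhood-balanced $k$-coloring of a graph is a (not necessarily proper) vertex coloring with colors $1,\dots,k$ such that every vertex has the same number of neighbors of each of the $k$ colors. For a nonempty proper subset $S\subsetneq V(G)$, the union of $n$ copies of $G$ over $S$, denoted $nG_S$, is the graph obtained by taking $n$ vertex-disjoint copies of $G$ and identifying, for each $s\in S$, the $n$ copies of $s$ into a single vertex (so the $n$ copies of the subgraph induced by $S$ are identified into one copy of it). A subset $S$ is independent if no two vertices of $S$ are adjacent. *)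

theory Defs
  imports Graph_Theory.Pair_Digraph
begin

text \<open>
  A finite simple undirected graph is a \<^locale>\<open>pair_graph\<close>: a finite vertex set together with a
  finite, symmetric, irreflexive set of arcs, an edge \<open>uv\<close> being the two arcs \<open>(u, v)\<close>, \<open>(v, u)\<close>.
\<close>

definition neighborhood :: "'a pair_pre_digraph \<Rightarrow> 'a \<Rightarrow> 'a set" where
  "neighborhood G v = {u. (v, u) \<in> parcs G}"

text \<open>The colouring need not be proper, and a colour in \<open>{1..k}\<close> may remain unused.\<close>

definition neighborhood_balanced_coloring ::
    "'a pair_pre_digraph \<Rightarrow> nat \<Rightarrow> ('a \<Rightarrow> nat) \<Rightarrow> bool" where
  "neighborhood_balanced_coloring G k c \<longleftrightarrow>
     c ` pverts G \<subseteq> {1..k} \<and>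
     (\<forall>v \<in> pverts G. \<forall>i \<in> {1..k}. \<forall>j \<in> {1..k}.
        card {u \<in> neighborhood G v. c u = i} = card {u \<in> neighborhood G v. c u = j})"

definition admits_neighborhood_balanced_coloring :: "'a pair_pre_digraph \<Rightarrow> nat \<Rightarrow> bool" where
  "admits_neighborhood_balanced_coloring G k \<longleftrightarrow> (\<exists>c. neighborhood_balanced_coloring G k c)"

definition independent_in :: "'a pair_pre_digraph \<Rightarrow> 'a set \<Rightarrow> bool" where
  "independent_in G S \<longleftrightarrow> (\<forall>u \<in> S. \<forall>v \<in> S. (u, v) \<notin> parcs G)"

definition disjoint_copies :: "nat \<Rightarrow> 'a pair_pre_digraph \<Rightarrow> (nat \<times> 'a) pair_pre_digraph" where
  "disjoint_copies n G =
     \<lparr> pverts = {..<n} \<times> pverts G,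
       parcs = {((i, u), (i, v)) | i u v. i < n \<and> (u, v) \<in> parcs G} \<rparr>"

definition identify_copies ::
    "nat \<Rightarrow> 'a pair_pre_digraph \<Rightarrow> 'a set \<Rightarrow> (nat \<times> 'a) rel" where
  "identify_copies n G S =
     {((i, v), (j, v)) | i j v. i < n \<and> j < n \<and> v \<in> pverts G \<and> (i = j \<or> v \<in> S)}"

definition quotient_graph :: "'a pair_pre_digraph \<Rightarrow> 'a rel \<Rightarrow> 'a set pair_pre_digraph" where
  "quotient_graph H r =
     \<lparr> pverts = pverts H // r,
       parcs = {(r `` {x}, r `` {y}) | x y. (x, y) \<in> parcs H} \<rparr>"

text \<open>
  The graph \<open>nG\<^sub>S\<close>. Its vertices are classes of pairs \<open>(i, v)\<close> (vertex \<open>v\<close> of copy \<open>i\<close>): the class of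
  \<open>(i, v)\<close> is \<open>{..<n} \<times> {v}\<close> if \<open>v \<in> S\<close>, and \<open>{(i, v)}\<close> otherwise.
\<close>

definition union_of_copies ::
    "nat \<Rightarrow> 'a pair_pre_digraph \<Rightarrow> 'a set \<Rightarrow> (nat \<times> 'a) set pair_pre_digraph" where
  "union_of_copies n G S = quotient_graph (disjoint_copies n G) (identify_copies n G S)"

lemma equiv_identify_copies:
  "equiv (pverts (disjoint_copies n G)) (identify_copies n G S)"
  by (rule equivI)
    (auto simp: identify_copies_def disjoint_copies_def refl_on_def intro!: symI transI)

lemma identify_copies_class:
  assumes "i < n" "v \<in> pverts G"
  shows "identify_copies n G S `` {(i, v)} = (if v \<in> S then {..<n} \<times> {v} else {(i, v)})"
  using assms by (auto simp: identify_copies_def)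

lemma pair_graph_union_of_copies:
  assumes "pair_graph G"
  shows "pair_graph (union_of_copies n G S)"
proof -
  interpret pair_graph G by fact
  let ?r = "identify_copies n G S" and ?H = "disjoint_copies n G"
  let ?U = "union_of_copies n G S"
  have arc: "\<exists>i u v. i < n \<and> (u, v) \<in> parcs G \<and> e = (?r `` {(i, u)}, ?r `` {(i, v)})"
    if "e \<in> parcs ?U" for e
    using that
    by (auto simp: union_of_copies_def quotient_graph_def disjoint_copies_def)
  have arcI: "(?r `` {(i, u)}, ?r `` {(i, v)}) \<in> parcs ?U" if "i < n" "(u, v) \<in> parcs G" for i u v
    using that
    by (auto simp: union_of_copies_def quotient_graph_def disjoint_copies_def)
  have vertI: "?r `` {(i, u)} \<in> pverts ?U" if "i < n" "u \<in> pverts G" for i u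
    using that
    by (auto simp: union_of_copies_def quotient_graph_def disjoint_copies_def intro: quotientI)
  have fin: "finite (pverts ?U)"
    using pair_finite_verts
    by (auto simp: union_of_copies_def quotient_graph_def disjoint_copies_def quotient_def)
  have ends: "fst e \<in> pverts ?U" "snd e \<in> pverts ?U" if "e \<in> parcs ?U" for e
    using arc[OF that] vertI in_arcsD1 in_arcsD2 by fastforce+
  have "parcs ?U \<subseteq> pverts ?U \<times> pverts ?U"
    using ends by force
  then have finarcs: "finite (parcs ?U)"
    using fin by (meson finite_SigmaI finite_subset)
  have loopfree: "fst e \<noteq> snd e" if "e \<in> parcs ?U" for e
  proof -
    from arc[OF that] obtain i u v where
      e: "i < n" "(u, v) \<in> parcs G" "e = (?r `` {(i, u)}, ?r `` {(i, v)})" by blast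
    then have "(i, u) \<in> fst e" "(i, u) \<notin> snd e"
      using in_arcsD1[OF e(2)] pair_no_loops[OF e(2)] by (auto simp: identify_copies_def)
    then show ?thesis by metis
  qed
  have "sym (parcs ?U)"
    by (rule symI) (use arc arcs_symmetric arcI in blast)
  then show ?thesis
    using fin finarcs ends loopfree by unfold_locales (auto simp: symmetric_def)
qed

end

theory Submission
  imports Defs
begin

text \<open>
  Every vertex of \<open>nG\<^sub>S\<close> lies over a single vertex of \<open>G\<close>, so a colouring of \<open>G\<close> can be pulled
  back to \<open>nG\<^sub>S\<close>. The pulled-back colouring is balanced because in \<open>nG\<^sub>S\<close> each colour occurs in
  a neighbourhood a fixed multiple of the number of times it occurs in the neighbourhood below.
  For a vertex outside \<open>S\<close> this multiple is \<open>1\<close>: its neighbours all come from its own copy of \<open>G\<close>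
  (\<open>neighborhood_union_of_copies_outside\<close>). For a vertex of \<open>S\<close> it is \<open>n\<close>: by independence its
  neighbours are outside \<open>S\<close>, so the \<open>n\<close> copies of its neighbourhood remain disjoint after the
  identification (\<open>neighborhood_union_of_copies_inside\<close>). Without independence, a neighbour in \<open>S\<close>
  would be counted once where a neighbour outside \<open>S\<close> is counted \<open>n\<close> times.
\<close>

abbreviation copy_class ::
    "nat \<Rightarrow> 'a pair_pre_digraph \<Rightarrow> 'a set \<Rightarrow> nat \<Rightarrow> 'a \<Rightarrow> (nat \<times> 'a) set" where
  "copy_class n G S i v \<equiv> identify_copies n G S `` {(i, v)}"

lemma copy_class_eq_iff:
  assumes "i < n" "j < n" "u \<in> pverts G" "v \<in> pverts G"
  shows "copy_class n G S i u = copy_class n G S j v \<longleftrightarrow> u = v \<and> (i = j \<or> v \<in> S)"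
  using assms by (auto simp: identify_copies_class)

lemma pverts_union_of_copies:
  "pverts (union_of_copies n G S) = {copy_class n G S i v | i v. i < n \<and> v \<in> pverts G}"
  by (auto simp: union_of_copies_def quotient_graph_def disjoint_copies_def quotient_def)

lemma parcs_union_of_copies:
  "parcs (union_of_copies n G S) =
     {(copy_class n G S i u, copy_class n G S i v) | i u v. i < n \<and> (u, v) \<in> parcs G}"
  unfolding union_of_copies_def quotient_graph_def disjoint_copies_def by simp

lemma neighborhood_subset_pverts:
  assumes "pair_graph G"
  shows "neighborhood G v \<subseteq> pverts G"
proof -
  interpret pair_graph G by fact
  show ?thesis by (auto simp: neighborhood_def dest: in_arcsD2)
qed

text \<open>
  The copies that contain the vertex are \<open>i\<close> alone, or all of them, according to whether \<open>v\<close> is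
  identified; each contributes its own copy of the neighbourhood.
\<close>

lemma neighborhood_union_of_copies:
  assumes "pair_graph G" "i < n" "v \<in> pverts G"
  shows "neighborhood (union_of_copies n G S) (copy_class n G S i v) =
    {copy_class n G S j u | j u. j < n \<and> (i = j \<or> v \<in> S) \<and> u \<in> neighborhood G v}"
proof -
  interpret pair_graph G by fact
  have "copy_class n G S i v = copy_class n G S j w \<longleftrightarrow> v = w \<and> (i = j \<or> v \<in> S)"
    if "j < n" "(w, u) \<in> parcs G" for j w u
    using copy_class_eq_iff[OF assms(2) that(1) assms(3) in_arcsD1[OF that(2)]] by auto
  then show ?thesis
    unfolding neighborhood_def parcs_union_of_copies by blast
qed

lemma neighborhood_union_of_copies_outside:
  assumes "pair_graph G" "i < n" "v \<in> pverts G" "v \<notin> S"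
  shows "neighborhood (union_of_copies n G S) (copy_class n G S i v) =
    copy_class n G S i ` neighborhood G v"
  using assms by (auto simp: neighborhood_union_of_copies)

lemma neighborhood_union_of_copies_inside:
  assumes "pair_graph G" "i < n" "v \<in> pverts G" "v \<in> S" "independent_in G S"
  shows "neighborhood (union_of_copies n G S) (copy_class n G S i v) =
    (\<lambda>x. {x}) ` ({..<n} \<times> neighborhood G v)"
proof -
  have "copy_class n G S j u = {(j, u)}" if "j < n" "u \<in> neighborhood G v" for j u
    using that assms neighborhood_subset_pverts[OF assms(1), of v]
    by (subst identify_copies_class) (auto simp: independent_in_def neighborhood_def)
  then show ?thesis
    unfolding neighborhood_union_of_copies[OF assms(1-3)] using assms(4) by fastforce
qed

text \<open>All members of a class share their second component, which makes \<open>the_elem\<close> meaningful.\<close>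

definition lift_coloring :: "('a \<Rightarrow> nat) \<Rightarrow> (nat \<times> 'a) set \<Rightarrow> nat" where
  "lift_coloring c X = c (the_elem (snd ` X))"

lemma lift_coloring_singleton: "lift_coloring c {(i, v)} = c v"
  by (simp add: lift_coloring_def)

lemma lift_coloring_copy_class:
  assumes "i < n" "v \<in> pverts G"
  shows "lift_coloring c (copy_class n G S i v) = c v"
proof -
  have "snd ` copy_class n G S i v = {v}"
    using assms by (force simp: identify_copies_class)
  then show ?thesis by (simp add: lift_coloring_def)
qed

lemma card_color_outside:
  assumes "pair_graph G" "i < n" "v \<in> pverts G" "v \<notin> S"
  shows "card {X \<in> neighborhood (union_of_copies n G S) (copy_class n G S i v).
      lift_coloring c X = a} = card {u \<in> neighborhood G v. c u = a}"
proof -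
  note N = subsetD[OF neighborhood_subset_pverts[OF assms(1), of v]]
  have "{X \<in> neighborhood (union_of_copies n G S) (copy_class n G S i v). lift_coloring c X = a} =
      copy_class n G S i ` {u \<in> neighborhood G v. c u = a}"
    unfolding neighborhood_union_of_copies_outside[OF assms]
    using lift_coloring_copy_class[OF assms(2) N] by auto
  moreover have "inj_on (copy_class n G S i) {u \<in> neighborhood G v. c u = a}"
    using assms(2) N by (intro inj_onI) (simp add: copy_class_eq_iff)
  ultimately show ?thesis by (simp add: card_image)
qed

lemma card_color_inside:
  assumes "pair_graph G" "i < n" "v \<in> pverts G" "v \<in> S" "independent_in G S"
  shows "card {X \<in> neighborhood (union_of_copies n G S) (copy_class n G S i v).
      lift_coloring c X = a} = n * card {u \<in> neighborhood G v. c u = a}"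
proof -
  have "{X \<in> neighborhood (union_of_copies n G S) (copy_class n G S i v). lift_coloring c X = a} =
      (\<lambda>x. {x}) ` ({..<n} \<times> {u \<in> neighborhood G v. c u = a})"
    unfolding neighborhood_union_of_copies_inside[OF assms]
    by (auto simp: lift_coloring_singleton)
  then show ?thesis by (simp add: card_image card_cartesian_product)
qed

lemma neighborhood_balanced_lift_coloring:
  assumes "pair_graph G" "independent_in G S" "neighborhood_balanced_coloring G k c"
  shows "neighborhood_balanced_coloring (union_of_copies n G S) k (lift_coloring c)"
  unfolding neighborhood_balanced_coloring_def
proof (intro conjI ballI)
  show "lift_coloring c ` pverts (union_of_copies n G S) \<subseteq> {1..k}"
    using assms(3) unfolding pverts_union_of_copies neighborhood_balanced_coloring_def
    by (auto simp: lift_coloring_copy_class)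
next
  fix X a b
  assume "X \<in> pverts (union_of_copies n G S)" and ab: "a \<in> {1..k}" "b \<in> {1..k}"
  then obtain i v where X: "X = copy_class n G S i v" and iv: "i < n" "v \<in> pverts G"
    by (auto simp: pverts_union_of_copies)
  have bal: "card {u \<in> neighborhood G v. c u = a} = card {u \<in> neighborhood G v. c u = b}"
    using assms(3) iv ab unfolding neighborhood_balanced_coloring_def by blast
  show "card {Y \<in> neighborhood (union_of_copies n G S) X. lift_coloring c Y = a} =
      card {Y \<in> neighborhood (union_of_copies n G S) X. lift_coloring c Y = b}"
  proof (cases "v \<in> S")
    case True
    then show ?thesis
      using bal by (simp only: X card_color_inside[OF assms(1) iv _ assms(2)])
  next
    case False
    then show ?thesis
      using bal by (simp only: X card_color_outside[OF assms(1) iv] not_False_eq_True)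
  qed
qed

theorem theorem3p8:
  fixes k n :: nat
    and G :: "'a pair_pre_digraph"
    and S :: "'a set"
  assumes "k \<ge> 2" and "n \<ge> 1"
    and "pair_graph G"
    and "admits_neighborhood_balanced_coloring G k"
    and "S \<noteq> {}" and "S \<subset> pverts G"
    and "independent_in G S"
  shows "admits_neighborhood_balanced_coloring (union_of_copies n G S) k"
  using assms neighborhood_balanced_lift_coloring
  unfolding admits_neighborhood_balanced_coloring_def by blast

end
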